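(* Let $h:[n]\to[n]$ be a Hessenberg function and let $m=m(\Gamma_h)$ be the maximum sink-set size of $\Gamma_h$. Let $T\in SK_m(\Gamma_h)$. Then the restriction map $$\{\omega\in\mathcal{A}_m(\Gamma_h) : \mathrm{sk}(\omega)=T\}\to\mathcal{A}(\Gamma_{h_T}),\qquad \omega\mapsto\omega_T,$$ is a bijection. Furthermore, for any $\omega\in\mathcal{A}_m(\Gamma_h)$ with $\mathrm{sk}(\omega)=T$ we have $\mathrm{asc}(\omega)=\deg(T)+\mathrm{asc}(\omega_T)$.
   Context: $[n]=\{1,\dots,n\}$. A Hessenberg function is a map $h:[n]\to[n]$ with $h(i)\ge i$ for all $i$ and $h(i+1)\ge h(i)$ for $i\in[n-1]$. The incomparability graph $\Gamma_h$ has vertex set $[n]$ and an edge $\{i,j\}$ (with $j<i$) exactly when $i\le h(j)$. $\mathcal{A}(\Gamma_h)$ is the set of acyclic orientations (no directed cycles) of $\Gamma_h$. For $\omega\in\mathcal{A}(\Gamma_h)$, $\mathrm{sk}(\omega)$ is its set of sinks (vertices all of whose incident edges point towards them), and $\mathrm{asc}(\omega)$ is the number of edges oriented from the smaller to the larger vertex. $\mathcal{A}_k(\Gamma_h)$ is the set of $\omega\in\mathcal{A}(\Gamma_h)$ with exactly $k$ sinks; $SK_k(\Gamma_h)$ is the set of $k$-element subsets of $[n]$ of the form $\mathrm{sk}(\omega)$, $\omega\in\mathcal{A}(\Gamma_h)$; $m(\Gamma_h)=\max\{|\mathrm{sk}(\omega)|:\omega\in\mathcal{A}(\Gamma_h)\}$;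 and $\deg(T)=\min\{\mathrm{asc}(\omega):\omega\in\mathcal{A}(\Gamma_h),\ \mathrm{sk}(\omega)=T\}$. For a sink set $T$ with $|T|=k$, let $\phi_T(j)=j-|\{i\in T:i\le j\}|$, which restricts to an order-preserving bijection $[n]\setminus T\to[n-k]$, and let $h_T:[n-k]\to[n-k]$ be the Hessenberg function with $h_T(\phi_T(i))=\phi_T(h(i))$ for $i\in[n]\setminus T$. Via $\phi_T$, $\Gamma_{h_T}$ is the induced subgraph of $\Gamma_h$ on $[n]\setminus T$; $\omega_T$ denotes the acyclic orientation of $\Gamma_{h_T}$ obtained by restricting $\omega$ to this induced subgraph. *)

theory Defs
  imports Main
begin

text \<open>
  A function on $[n]$ is a total function on the naturals of which only the values on
  \<open>{1..n}\<close> matter.  The case \<open>n = 0\<close> is allowed throughout; it arises as the domain of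
  \<open>hess_del n h T\<close> when \<open>T\<close> is all of \<open>{1..n}\<close>.
\<close>

definition hessenberg :: "nat \<Rightarrow> (nat \<Rightarrow> nat) \<Rightarrow> bool" where
  "hessenberg n h \<longleftrightarrow>
     (\<forall>i\<in>{1..n}. h i \<in> {1..n} \<and> i \<le> h i) \<and>
     (\<forall>i\<in>{1..<n}. h i \<le> h (i + 1))"

definition inc_edges :: "nat \<Rightarrow> (nat \<Rightarrow> nat) \<Rightarrow> nat set set" where
  "inc_edges n h = {{i, j} | i j. i \<in> {1..n} \<and> j \<in> {1..n} \<and> j < i \<and> i \<le> h j}"

text \<open>An orientation is a set of arcs; \<open>(v, w)\<close> is the edge \<open>{v, w}\<close> directed from \<open>v\<close> to \<open>w\<close>.\<close>

definition orientations :: "nat \<Rightarrow> (nat \<Rightarrow> nat) \<Rightarrow> (nat \<times> nat) set set" where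
  "orientations n h =
     {\<omega>. (\<forall>(v, w)\<in>\<omega>. {v, w} \<in> inc_edges n h) \<and>
         (\<forall>v w. {v, w} \<in> inc_edges n h \<longrightarrow> ((v, w) \<in> \<omega> \<longleftrightarrow> (w, v) \<notin> \<omega>))}"

definition acyc_orients :: "nat \<Rightarrow> (nat \<Rightarrow> nat) \<Rightarrow> (nat \<times> nat) set set" where
  "acyc_orients n h = {\<omega> \<in> orientations n h. acyclic \<omega>}"

definition sinks :: "nat \<Rightarrow> (nat \<Rightarrow> nat) \<Rightarrow> (nat \<times> nat) set \<Rightarrow> nat set" where
  "sinks n h \<omega> = {v \<in> {1..n}. \<forall>w. {v, w} \<in> inc_edges n h \<longrightarrow> (w, v) \<in> \<omega>}"

definition asc :: "(nat \<times> nat) set \<Rightarrow> nat" where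
  "asc \<omega> = card {(v, w) \<in> \<omega>. v < w}"

definition acyc_orients_sinks :: "nat \<Rightarrow> (nat \<Rightarrow> nat) \<Rightarrow> nat \<Rightarrow> (nat \<times> nat) set set" where
  "acyc_orients_sinks n h k = {\<omega> \<in> acyc_orients n h. card (sinks n h \<omega>) = k}"

definition sink_sets :: "nat \<Rightarrow> (nat \<Rightarrow> nat) \<Rightarrow> nat \<Rightarrow> nat set set" where
  "sink_sets n h k =
     {T. T \<subseteq> {1..n} \<and> card T = k \<and> (\<exists>\<omega> \<in> acyc_orients n h. T = sinks n h \<omega>)}"

text \<open>
  The set of acyclic orientations is finite and nonempty, so \<open>Max\<close> is applied to a finite
  nonempty set; so is \<open>Min\<close> below whenever \<open>T\<close> is a sink set.
\<close>

definition max_sink_size :: "nat \<Rightarrow> (nat \<Rightarrow> nat) \<Rightarrow> nat" where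
  "max_sink_size n h = Max {card (sinks n h \<omega>) | \<omega>. \<omega> \<in> acyc_orients n h}"

definition sink_deg :: "nat \<Rightarrow> (nat \<Rightarrow> nat) \<Rightarrow> nat set \<Rightarrow> nat" where
  "sink_deg n h T = Min {asc \<omega> | \<omega>. \<omega> \<in> acyc_orients n h \<and> sinks n h \<omega> = T}"

text \<open>The subtraction never truncates when \<open>0 \<notin> T\<close>.\<close>

definition relabel :: "nat set \<Rightarrow> nat \<Rightarrow> nat" where
  "relabel T j = j - card {i \<in> T. i \<le> j}"

text \<open>
  The function $h_T$, given on \<open>{1..n - card T}\<close> by
  $h_T(\phi_T(i)) = \phi_T(h(i))$ for $i \in [n] \setminus T$;
  see \<open>hess_del_relabel\<close> and \<open>hessenberg_hess_del\<close>.
\<close>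

definition hess_del :: "nat \<Rightarrow> (nat \<Rightarrow> nat) \<Rightarrow> nat set \<Rightarrow> nat \<Rightarrow> nat" where
  "hess_del n h T j = relabel T (h (inv_into ({1..n} - T) (relabel T) j))"

definition restrict_orient :: "nat set \<Rightarrow> (nat \<times> nat) set \<Rightarrow> (nat \<times> nat) set" where
  "restrict_orient T \<omega> = {(relabel T v, relabel T w) | v w. (v, w) \<in> \<omega> \<and> v \<notin> T \<and> w \<notin> T}"

lemma relabel_eq_card:
  assumes "T \<subseteq> {1..n}"
  shows "relabel T j = card ({1..j} - T)"
proof -
  have "{i \<in> T. i \<le> j} = {1..j} \<inter> T" using assms by auto
  moreover have "card ({1..j} - T) = card {1..j} - card ({1..j} \<inter> T)"
    by (rule card_Diff_subset_Int) simp
  ultimately show ?thesis by (simp add: relabel_def)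
qed

lemma relabel_mono:
  assumes "T \<subseteq> {1..n}" "i \<le> j"
  shows "relabel T i \<le> relabel T j"
  unfolding relabel_eq_card[OF assms(1)] using assms(2) by (intro card_mono) auto

lemma relabel_strict_mono:
  assumes "T \<subseteq> {1..n}" "i < j" "j \<notin> T"
  shows "relabel T i < relabel T j"
  unfolding relabel_eq_card[OF assms(1)]
proof (rule psubset_card_mono)
  have "j \<in> {1..j} - T" "j \<notin> {1..i} - T" using assms by auto
  moreover have "{1..i} - T \<subseteq> {1..j} - T" using assms(2) by auto
  ultimately show "{1..i} - T \<subset> {1..j} - T" by blast
qed simp

lemma bij_betw_relabel:
  assumes "T \<subseteq> {1..n}"
  shows "bij_betw (relabel T) ({1..n} - T) {1..n - card T}"
proof -
  have inj: "inj_on (relabel T) ({1..n} - T)"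
    using relabel_strict_mono[OF assms] by (intro inj_onI) (metis DiffD2 less_irrefl linorder_neqE_nat)
  have fin: "finite T" using assms finite_subset by blast
  have card: "card ({1..n} - T) = n - card T"
    using assms fin by (simp add: card_Diff_subset)
  have "relabel T ` ({1..n} - T) \<subseteq> {1..n - card T}"
  proof (rule image_subsetI)
    fix i assume i: "i \<in> {1..n} - T"
    then have "relabel T 0 < relabel T i"
      using relabel_strict_mono[OF assms, of 0 i] by auto
    moreover have "relabel T i \<le> relabel T n"
      using relabel_mono[OF assms] i by auto
    moreover have "relabel T n = n - card T"
      using card relabel_eq_card[OF assms] by simp
    ultimately show "relabel T i \<in> {1..n - card T}" by auto
  qed
  moreover have "card (relabel T ` ({1..n} - T)) = card {1..n - card T}"
    using card_image[OF inj] card by simp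
  ultimately have "relabel T ` ({1..n} - T) = {1..n - card T}"
    by (intro card_subset_eq) auto
  with inj show ?thesis by (simp add: bij_betw_def)
qed

lemma hess_del_relabel:
  assumes "T \<subseteq> {1..n}" "i \<in> {1..n} - T"
  shows "hess_del n h T (relabel T i) = relabel T (h i)"
  using bij_betw_inv_into_left[OF bij_betw_relabel[OF assms(1)] assms(2)]
  by (simp add: hess_del_def)

lemma hessenberg_mono:
  assumes "hessenberg n h" "1 \<le> i" "i \<le> j" "j \<le> n"
  shows "h i \<le> h j"
  using assms(3,4)
proof (induction j rule: dec_induct)
  case (step j)
  then have "h j \<le> h (j + 1)" using assms(1,2) unfolding hessenberg_def by auto
  with step show ?case by simp
qed simp

lemma hessenberg_hess_del:
  assumes h: "hessenberg n h" and T: "T \<subseteq> {1..n}"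
  shows "hessenberg (n - card T) (hess_del n h T)"
proof -
  have bij: "bij_betw (relabel T) ({1..n} - T) {1..n - card T}"
    using bij_betw_relabel[OF T] .
  have ex: "\<exists>i \<in> {1..n} - T. relabel T i = a" if "a \<in> {1..n - card T}" for a
    using bij_betw_imp_surj_on[OF bij] that by (metis imageE)
  have top: "relabel T n = n - card T"
    using relabel_eq_card[OF T, of n] T finite_subset[OF T]
    by (simp add: card_Diff_subset)
  have "hess_del n h T a \<in> {1..n - card T} \<and> a \<le> hess_del n h T a"
    if a: "a \<in> {1..n - card T}" for a
  proof -
    obtain i where i: "i \<in> {1..n} - T" "relabel T i = a" using ex[OF a] by blast
    have "i \<le> h i" "h i \<le> n" using h i(1) unfolding hessenberg_def by auto
    then have "a \<le> relabel T (h i)" "relabel T (h i) \<le> n - card T"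
      using relabel_mono[OF T] i(2) top by metis+
    then show ?thesis using hess_del_relabel[OF T i(1), of h] i(2) a by auto
  qed
  moreover have "hess_del n h T a \<le> hess_del n h T (a + 1)" if a: "a \<in> {1..<n - card T}" for a
  proof -
    obtain i where i: "i \<in> {1..n} - T" "relabel T i = a" using ex[of a] a by auto
    obtain j where j: "j \<in> {1..n} - T" "relabel T j = a + 1" using ex[of "a + 1"] a by auto
    have "i \<le> j" using relabel_mono[OF T, of j i] i(2) j(2) by (cases "i \<le> j") auto
    then have "h i \<le> h j" using hessenberg_mono[OF h] i(1) j(1) by auto
    then show ?thesis
      using hess_del_relabel[OF T i(1), of h] hess_del_relabel[OF T j(1), of h] i(2) j(2)
        relabel_mono[OF T] by metis
  qed
  ultimately show ?thesis unfolding hessenberg_def by blast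
qed

end

theory Submission
  imports Defs
begin

text \<open>
  A sink set is independent, and conversely every independent set \<open>S\<close> lies inside the sink
  set of some acyclic orientation: send all edges at \<open>S\<close> into \<open>S\<close> and orient the remaining
  ones downwards (\<open>rank_orient_sink_rank\<close>).  So a sink set \<open>T\<close> of maximum size is a maximal
  independent set, that is, every vertex outside \<open>T\<close> has a neighbour in \<open>T\<close>
  (\<open>max_sink_set_dominating\<close>).

  An orientation whose sink set is \<open>T\<close> has no choice on the edges that meet \<open>T\<close>, hence is
  determined by its restriction to the complement.  In the other direction, take any acyclic
  orientation of the complement and direct all edges at \<open>T\<close> into \<open>T\<close>.  No cycle arises,
  because no arc leaves \<open>T\<close>, and no vertex outside \<open>T\<close> becomes a sink, because it has a
  neighbour in \<open>T\<close>; the latter is where maximality enters.  The two constructions are inverse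
  to each other.

  The ascents of an orientation with sink set \<open>T\<close> are those into \<open>T\<close>, whose number depends
  on \<open>T\<close> alone, and those of the restriction (\<open>asc_split\<close>).  The restriction may
  have no ascents at all, so the first number is the minimum \<open>sink_deg n h T\<close>.
\<close>

section \<open>Edges and orientations\<close>

lemma inc_edge_iff:
  "{v, w} \<in> inc_edges n h \<longleftrightarrow>
     v \<in> {1..n} \<and> w \<in> {1..n} \<and> (w < v \<and> v \<le> h w \<or> v < w \<and> w \<le> h v)"
  unfolding inc_edges_def by (auto simp: doubleton_eq_iff)

lemma orientations_arcD:
  assumes "\<omega> \<in> orientations n h" "(v, w) \<in> \<omega>"
  shows "{v, w} \<in> inc_edges n h" "v \<in> {1..n}" "w \<in> {1..n}" "v \<noteq> w"
proof -
  show e: "{v, w} \<in> inc_edges n h" using assms unfolding orientations_def by blast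
  show "v \<in> {1..n}" "w \<in> {1..n}" "v \<noteq> w" using e unfolding inc_edge_iff by auto
qed

lemma orientations_flip:
  assumes "\<omega> \<in> orientations n h" "{v, w} \<in> inc_edges n h"
  shows "(v, w) \<in> \<omega> \<longleftrightarrow> (w, v) \<notin> \<omega>"
  using assms unfolding orientations_def by blast

lemma orientations_subset:
  assumes "\<omega> \<in> orientations n h"
  shows "\<omega> \<subseteq> {1..n} \<times> {1..n}"
  using orientations_arcD[OF assms] by auto

lemma finite_acyc_orients: "finite (acyc_orients n h)"
proof (rule finite_subset)
  show "acyc_orients n h \<subseteq> Pow ({1..n} \<times> {1..n})"
    unfolding acyc_orients_def using orientations_subset by blast
qed simp

lemma card_sinks_le_max_sink_size:
  assumes "\<omega> \<in> acyc_orients n h"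
  shows "card (sinks n h \<omega>) \<le> max_sink_size n h"
  unfolding max_sink_size_def
proof (rule Max_ge)
  show "finite {card (sinks n h \<omega>) |\<omega>. \<omega> \<in> acyc_orients n h}"
    using finite_acyc_orients by (simp add: setcompr_eq_image)
qed (use assms in blast)

section \<open>Maximum sink sets are maximal independent sets\<close>

definition independent :: "nat \<Rightarrow> (nat \<Rightarrow> nat) \<Rightarrow> nat set \<Rightarrow> bool" where
  "independent n h S \<longleftrightarrow> S \<subseteq> {1..n} \<and> (\<forall>v\<in>S. \<forall>w\<in>S. {v, w} \<notin> inc_edges n h)"

definition dominating :: "nat \<Rightarrow> (nat \<Rightarrow> nat) \<Rightarrow> nat set \<Rightarrow> bool" where
  "dominating n h S \<longleftrightarrow> (\<forall>v\<in>{1..n} - S. \<exists>w\<in>S. {v, w} \<in> inc_edges n h)"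

text \<open>Two adjacent sinks would force their common edge to point both ways.\<close>

lemma independent_sinks:
  assumes "\<omega> \<in> orientations n h"
  shows "independent n h (sinks n h \<omega>)"
proof -
  have "{v, w} \<notin> inc_edges n h" if "v \<in> sinks n h \<omega>" "w \<in> sinks n h \<omega>" for v w
  proof
    assume e: "{v, w} \<in> inc_edges n h"
    then have "(w, v) \<in> \<omega>" using that(1) unfolding sinks_def by blast
    moreover have "(v, w) \<in> \<omega>"
      using that(2) e unfolding sinks_def by (auto simp: insert_commute)
    ultimately show False using orientations_flip[OF assms e] by blast
  qed
  then show ?thesis unfolding independent_def sinks_def by blast
qed

definition rank_orient :: "nat \<Rightarrow> (nat \<Rightarrow> nat) \<Rightarrow> (nat \<Rightarrow> nat) \<Rightarrow> (nat \<times> nat) set" where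
  "rank_orient n h r = {(v, w). {v, w} \<in> inc_edges n h \<and> r w < r v}"

lemma rank_orient_acyc_orients:
  assumes "\<And>v w. {v, w} \<in> inc_edges n h \<Longrightarrow> r v \<noteq> r w"
  shows "rank_orient n h r \<in> acyc_orients n h"
proof -
  have "(v, w) \<in> rank_orient n h r \<longleftrightarrow> (w, v) \<notin> rank_orient n h r"
    if e: "{v, w} \<in> inc_edges n h" for v w
  proof -
    have "{w, v} \<in> inc_edges n h" using e by (simp add: insert_commute)
    then show ?thesis using e assms[OF e] unfolding rank_orient_def by auto
  qed
  then have "rank_orient n h r \<in> orientations n h"
    unfolding orientations_def by (simp add: rank_orient_def)
  moreover have "acyclic (rank_orient n h r)"
  proof -
    have "(rank_orient n h r)\<inverse> \<subseteq> measure r" unfolding rank_orient_def by auto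
    then have "wf ((rank_orient n h r)\<inverse>)" by (rule wf_subset[OF wf_measure])
    then show ?thesis using wf_acyclic acyclic_converse by blast
  qed
  ultimately show ?thesis by (simp add: acyc_orients_def)
qed

text \<open>
  Vertices of the graph are positive, so rank \<open>0\<close> puts exactly \<open>S\<close> at the bottom; outside
  \<open>S\<close> all edges run downwards.
\<close>

definition sink_rank :: "nat set \<Rightarrow> nat \<Rightarrow> nat" where
  "sink_rank S v = (if v \<in> S then 0 else v)"

lemma rank_orient_sink_rank:
  assumes "independent n h S"
  shows "rank_orient n h (sink_rank S) \<in> acyc_orients n h"
    and "S \<subseteq> sinks n h (rank_orient n h (sink_rank S))"
proof -
  show "rank_orient n h (sink_rank S) \<in> acyc_orients n h"
  proof (rule rank_orient_acyc_orients)
    fix v w assume e: "{v, w} \<in> inc_edges n h"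
    then have "\<not> (v \<in> S \<and> w \<in> S)" using assms unfolding independent_def by blast
    then show "sink_rank S v \<noteq> sink_rank S w"
      using e unfolding inc_edge_iff sink_rank_def by auto
  qed
  show "S \<subseteq> sinks n h (rank_orient n h (sink_rank S))"
  proof
    fix v assume v: "v \<in> S"
    have "(w, v) \<in> rank_orient n h (sink_rank S)" if e: "{v, w} \<in> inc_edges n h" for w
    proof -
      have "w \<notin> S" using v e assms unfolding independent_def by blast
      moreover have "0 < w" using e unfolding inc_edge_iff by auto
      ultimately show ?thesis
        using v e by (simp add: rank_orient_def sink_rank_def insert_commute)
    qed
    then show "v \<in> sinks n h (rank_orient n h (sink_rank S))"
      using v assms unfolding sinks_def independent_def by blast
  qed
qed

lemma independent_card_le_max_sink_size:
  assumes "independent n h S"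
  shows "card S \<le> max_sink_size n h"
proof -
  let ?\<omega> = "rank_orient n h (sink_rank S)"
  have "card S \<le> card (sinks n h ?\<omega>)"
    using rank_orient_sink_rank(2)[OF assms] by (intro card_mono) (auto simp: sinks_def)
  then show ?thesis
    using card_sinks_le_max_sink_size[OF rank_orient_sink_rank(1)[OF assms]] by simp
qed

text \<open>A vertex without neighbours in \<open>T\<close> could be added to the independent set \<open>T\<close>.\<close>

lemma max_sink_set_dominating:
  assumes ind: "independent n h T" and max: "card T = max_sink_size n h"
  shows "dominating n h T"
  unfolding dominating_def
proof (rule ballI, rule ccontr)
  fix v assume v: "v \<in> {1..n} - T" and no: "\<not> (\<exists>w\<in>T. {v, w} \<in> inc_edges n h)"
  have "{v, v} \<notin> inc_edges n h" unfolding inc_edge_iff by simp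
  then have "independent n h (insert v T)"
    using ind v no unfolding independent_def by (auto simp: insert_commute)
  then have "card (insert v T) \<le> card T"
    using independent_card_le_max_sink_size max by metis
  moreover have "finite T" using ind finite_subset unfolding independent_def by blast
  ultimately show False using v by simp
qed

text \<open>
  If every edge at \<open>T\<close> points into \<open>T\<close>, domination gives each vertex outside \<open>T\<close> an
  outgoing arc.
\<close>

lemma sinks_eq_dominating:
  assumes \<omega>: "\<omega> \<in> orientations n h" and T: "T \<subseteq> sinks n h \<omega>" and dom: "dominating n h T"
  shows "sinks n h \<omega> = T"
proof (rule antisym[OF _ T], rule subsetI, rule ccontr)
  fix v assume v: "v \<in> sinks n h \<omega>" "v \<notin> T"
  then obtain w where "w \<in> T" "{v, w} \<in> inc_edges n h"
    using dom unfolding dominating_def sinks_def by blast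
  then show False using independent_sinks[OF \<omega>] v(1) T unfolding independent_def by blast
qed

section \<open>Restricting and extending orientations\<close>

lemma relabel_less_iff:
  assumes "T \<subseteq> {1..n}" "i \<notin> T" "j \<notin> T"
  shows "relabel T i < relabel T j \<longleftrightarrow> i < j"
  using relabel_strict_mono[OF assms(1) _ assms(3)] relabel_mono[OF assms(1), of j i]
  by (metis leD leI)

lemma relabel_inj:
  assumes "T \<subseteq> {1..n}" "i \<notin> T" "j \<notin> T" "relabel T i = relabel T j"
  shows "i = j"
  using relabel_less_iff[OF assms(1)] assms(2-4) by (metis less_irrefl linorder_neqE_nat)

lemma relabel_surj:
  assumes "T \<subseteq> {1..n}" "a \<in> {1..n - card T}"
  obtains i where "i \<in> {1..n} - T" "relabel T i = a"
  using bij_betw_imp_surj_on[OF bij_betw_relabel[OF assms(1)]] assms(2) by (metis imageE)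

text \<open>
  The value \<open>h j\<close> may lie in \<open>T\<close>, where \<open>relabel T\<close> is only weakly monotone; it is enough
  that the other side \<open>i\<close> of the comparison \<open>i \<le> h j\<close> lies outside \<open>T\<close>.
\<close>

lemma inc_edges_hess_del_iff:
  assumes T: "T \<subseteq> {1..n}" and v: "v \<in> {1..n} - T" and w: "w \<in> {1..n} - T"
  shows "{relabel T v, relabel T w} \<in> inc_edges (n - card T) (hess_del n h T)
           \<longleftrightarrow> {v, w} \<in> inc_edges n h"
proof -
  have le: "relabel T i \<le> relabel T j \<longleftrightarrow> i \<le> j" if "i \<notin> T" for i j
    using relabel_mono[OF T, of i j] relabel_strict_mono[OF T, of j i] that by (metis leD leI)
  have "relabel T v \<in> {1..n - card T}" "relabel T w \<in> {1..n - card T}"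
    using bij_betwE[OF bij_betw_relabel[OF T]] v w by blast+
  then show ?thesis
    using v w unfolding inc_edge_iff
    by (simp add: hess_del_relabel[OF T] relabel_less_iff[OF T] le del: atLeastAtMost_iff)
qed

lemma restrict_orient_relabel_iff:
  assumes "T \<subseteq> {1..n}" "v \<notin> T" "w \<notin> T"
  shows "(relabel T v, relabel T w) \<in> restrict_orient T \<omega> \<longleftrightarrow> (v, w) \<in> \<omega>"
  using assms(2,3) relabel_inj[OF assms(1)] unfolding restrict_orient_def by blast

text \<open>
  Every vertex of the smaller graph has the form \<open>relabel T v\<close>, so being an orientation can
  be checked on the edges of \<open>\<Gamma>\<^sub>h\<close> outside \<open>T\<close>.
\<close>

lemma orientations_hess_delI:
  assumes T: "T \<subseteq> {1..n}"
    and sub: "\<omega> \<subseteq> {1..n - card T} \<times> {1..n - card T}"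
    and edge: "\<And>v w. v \<in> {1..n} - T \<Longrightarrow> w \<in> {1..n} - T \<Longrightarrow>
                 (relabel T v, relabel T w) \<in> \<omega> \<Longrightarrow> {v, w} \<in> inc_edges n h"
    and flip: "\<And>v w. v \<in> {1..n} - T \<Longrightarrow> w \<in> {1..n} - T \<Longrightarrow> {v, w} \<in> inc_edges n h \<Longrightarrow>
                 (relabel T v, relabel T w) \<in> \<omega> \<longleftrightarrow> (relabel T w, relabel T v) \<notin> \<omega>"
  shows "\<omega> \<in> orientations (n - card T) (hess_del n h T)"
proof -
  let ?E = "inc_edges (n - card T) (hess_del n h T)"
  have "{a, b} \<in> ?E" if "(a, b) \<in> \<omega>" for a b
  proof -
    have "a \<in> {1..n - card T}" "b \<in> {1..n - card T}" using sub that by auto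
    then obtain v w where "v \<in> {1..n} - T" "relabel T v = a" "w \<in> {1..n} - T" "relabel T w = b"
      using relabel_surj[OF T] by metis
    then show ?thesis using edge that inc_edges_hess_del_iff[OF T] by blast
  qed
  moreover have "(a, b) \<in> \<omega> \<longleftrightarrow> (b, a) \<notin> \<omega>" if e: "{a, b} \<in> ?E" for a b
  proof -
    have "a \<in> {1..n - card T}" "b \<in> {1..n - card T}" using e unfolding inc_edge_iff by auto
    then obtain v w where "v \<in> {1..n} - T" "relabel T v = a" "w \<in> {1..n} - T" "relabel T w = b"
      using relabel_surj[OF T] by metis
    then show ?thesis using flip e inc_edges_hess_del_iff[OF T] by blast
  qed
  ultimately show ?thesis unfolding orientations_def by blast
qed

lemma restrict_orient_acyc_orients:
  assumes T: "T \<subseteq> {1..n}" and \<omega>: "\<omega> \<in> acyc_orients n h"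
  shows "restrict_orient T \<omega> \<in> acyc_orients (n - card T) (hess_del n h T)"
proof -
  have or: "\<omega> \<in> orientations n h" and ac: "acyclic \<omega>"
    using \<omega> unfolding acyc_orients_def by auto
  have "restrict_orient T \<omega> \<in> orientations (n - card T) (hess_del n h T)"
  proof (rule orientations_hess_delI[OF T])
    show "restrict_orient T \<omega> \<subseteq> {1..n - card T} \<times> {1..n - card T}"
      using bij_betwE[OF bij_betw_relabel[OF T]] orientations_arcD(2,3)[OF or]
      unfolding restrict_orient_def by blast
  next
    fix v w assume "v \<in> {1..n} - T" "w \<in> {1..n} - T"
    then have iff: "(relabel T v, relabel T w) \<in> restrict_orient T \<omega> \<longleftrightarrow> (v, w) \<in> \<omega>"
        "(relabel T w, relabel T v) \<in> restrict_orient T \<omega> \<longleftrightarrow> (w, v) \<in> \<omega>"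
      using restrict_orient_relabel_iff[OF T] by blast+
    show "{v, w} \<in> inc_edges n h" if "(relabel T v, relabel T w) \<in> restrict_orient T \<omega>"
      by (rule orientations_arcD(1)[OF or that[unfolded iff]])
    show "(relabel T v, relabel T w) \<in> restrict_orient T \<omega> \<longleftrightarrow>
            (relabel T w, relabel T v) \<notin> restrict_orient T \<omega>" if "{v, w} \<in> inc_edges n h"
      using orientations_flip[OF or that] unfolding iff .
  qed
  moreover have "acyclic (restrict_orient T \<omega>)"
  proof -
    have lift: "\<exists>v w. v \<notin> T \<and> w \<notin> T \<and> relabel T v = a \<and> relabel T w = b \<and> (v, w) \<in> \<omega>\<^sup>+"
      if "(a, b) \<in> (restrict_orient T \<omega>)\<^sup>+" for a b
      using that
    proof (induction rule: trancl_induct)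
      case (base b)
      then show ?case unfolding restrict_orient_def by blast
    next
      case (step b c)
      then obtain v w where vw: "v \<notin> T" "w \<notin> T" "relabel T v = a" "relabel T w = b" "(v, w) \<in> \<omega>\<^sup>+"
        by blast
      from step.hyps(2) obtain w' x where
        x: "w' \<notin> T" "x \<notin> T" "relabel T w' = b" "relabel T x = c" "(w', x) \<in> \<omega>"
        unfolding restrict_orient_def by blast
      have "w' = w" using relabel_inj[OF T] vw x by metis
      then show ?case using vw x trancl_into_trancl by metis
    qed
    have False if "(a, a) \<in> (restrict_orient T \<omega>)\<^sup>+" for a
      using lift[OF that] relabel_inj[OF T] ac unfolding acyclic_def by metis
    then show ?thesis unfolding acyclic_def by blast
  qed
  ultimately show ?thesis by (simp add: acyc_orients_def)
qed

text \<open>The inverse of the restriction map when \<open>T\<close> is independent and dominating.\<close>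

definition extend_orient ::
  "nat \<Rightarrow> (nat \<Rightarrow> nat) \<Rightarrow> nat set \<Rightarrow> (nat \<times> nat) set \<Rightarrow> (nat \<times> nat) set" where
  "extend_orient n h T \<omega> =
     {(v, w). {v, w} \<in> inc_edges n h \<and> v \<notin> T \<and> (w \<in> T \<or> (relabel T v, relabel T w) \<in> \<omega>)}"

lemma extend_orient_acyc_orients:
  assumes ind: "independent n h T"
    and \<omega>: "\<omega> \<in> acyc_orients (n - card T) (hess_del n h T)"
  shows "extend_orient n h T \<omega> \<in> acyc_orients n h"
proof -
  have T: "T \<subseteq> {1..n}" using ind unfolding independent_def by blast
  have or: "\<omega> \<in> orientations (n - card T) (hess_del n h T)" and ac: "acyclic \<omega>"
    using \<omega> unfolding acyc_orients_def by auto
  let ?X = "extend_orient n h T \<omega>"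
  have "(v, w) \<in> ?X \<longleftrightarrow> (w, v) \<notin> ?X" if e: "{v, w} \<in> inc_edges n h" for v w
  proof -
    have e': "{w, v} \<in> inc_edges n h" using e by (simp add: insert_commute)
    consider "v \<in> T" "w \<notin> T" | "v \<notin> T" "w \<in> T" | "v \<notin> T" "w \<notin> T"
      using e ind unfolding independent_def by blast
    then show ?thesis
    proof cases
      case 3
      then have "v \<in> {1..n} - T" "w \<in> {1..n} - T" using e unfolding inc_edge_iff by auto
      then have "{relabel T v, relabel T w} \<in> inc_edges (n - card T) (hess_del n h T)"
        using e inc_edges_hess_del_iff[OF T] by blast
      then show ?thesis using orientations_flip[OF or] 3 e e' by (simp add: extend_orient_def)
    qed (use e e' in \<open>simp_all add: extend_orient_def\<close>)
  qed
  then have "?X \<in> orientations n h"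
    unfolding orientations_def by (simp add: extend_orient_def)
  moreover have "acyclic ?X"
  proof -
    \<comment> \<open>A walk starts outside \<open>T\<close> and stops as soon as it enters \<open>T\<close>.\<close>
    have walk: "v \<notin> T \<and> (w \<in> T \<or> (relabel T v, relabel T w) \<in> \<omega>\<^sup>+)" if "(v, w) \<in> ?X\<^sup>+" for v w
      using that
    proof (induction rule: trancl_induct)
      case (base w)
      then show ?case unfolding extend_orient_def by blast
    next
      case (step w x)
      then have "w \<notin> T" "x \<in> T \<or> (relabel T w, relabel T x) \<in> \<omega>"
        unfolding extend_orient_def by blast+
      then show ?case using step.IH by (meson trancl_into_trancl)
    qed
    then show ?thesis using ac unfolding acyclic_def by blast
  qed
  ultimately show ?thesis by (simp add: acyc_orients_def)
qed

lemma sinks_extend_orient: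
  assumes ind: "independent n h T" and dom: "dominating n h T"
    and \<omega>: "\<omega> \<in> acyc_orients (n - card T) (hess_del n h T)"
  shows "sinks n h (extend_orient n h T \<omega>) = T"
proof (rule sinks_eq_dominating[OF _ _ dom])
  show "extend_orient n h T \<omega> \<in> orientations n h"
    using extend_orient_acyc_orients[OF ind \<omega>] by (simp add: acyc_orients_def)
  show "T \<subseteq> sinks n h (extend_orient n h T \<omega>)"
    using ind unfolding independent_def sinks_def extend_orient_def
    by (auto simp: insert_commute)
qed

lemma restrict_extend_orient:
  assumes T: "T \<subseteq> {1..n}" and \<omega>: "\<omega> \<in> orientations (n - card T) (hess_del n h T)"
  shows "restrict_orient T (extend_orient n h T \<omega>) = \<omega>"
proof
  show "restrict_orient T (extend_orient n h T \<omega>) \<subseteq> \<omega>"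
    unfolding restrict_orient_def extend_orient_def by auto
  show "\<omega> \<subseteq> restrict_orient T (extend_orient n h T \<omega>)"
  proof (rule subrelI)
    fix a b assume ab: "(a, b) \<in> \<omega>"
    obtain v w where vw: "v \<in> {1..n} - T" "relabel T v = a" "w \<in> {1..n} - T" "relabel T w = b"
      using relabel_surj[OF T] orientations_arcD(2,3)[OF \<omega> ab] by metis
    then have "{v, w} \<in> inc_edges n h"
      using orientations_arcD(1)[OF \<omega> ab] inc_edges_hess_del_iff[OF T] by blast
    then have "(v, w) \<in> extend_orient n h T \<omega>"
      using vw ab unfolding extend_orient_def by blast
    then show "(a, b) \<in> restrict_orient T (extend_orient n h T \<omega>)"
      using vw unfolding restrict_orient_def by blast
  qed
qed

text \<open>A sink set dictates the orientation of every edge that meets it.\<close>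

lemma extend_restrict_orient:
  assumes \<omega>: "\<omega> \<in> orientations n h"
  shows "extend_orient n h (sinks n h \<omega>) (restrict_orient (sinks n h \<omega>) \<omega>) = \<omega>"
proof -
  let ?T = "sinks n h \<omega>"
  have T: "?T \<subseteq> {1..n}" unfolding sinks_def by blast
  have into: "(v, w) \<in> \<omega>" if "{v, w} \<in> inc_edges n h" "w \<in> ?T" for v w
    using that unfolding sinks_def by (simp add: insert_commute)
  have out: "v \<notin> ?T" if "(v, w) \<in> \<omega>" for v w
    using that orientations_arcD(1)[OF \<omega> that] orientations_flip[OF \<omega>]
    unfolding sinks_def by blast
  show ?thesis
    using into out orientations_arcD(1)[OF \<omega>] restrict_orient_relabel_iff[OF T]
    unfolding extend_orient_def by blast
qed

lemma bij_betw_restrict_orient: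
  assumes ind: "independent n h T" and dom: "dominating n h T"
  shows "bij_betw (restrict_orient T) {\<omega> \<in> acyc_orients n h. sinks n h \<omega> = T}
           (acyc_orients (n - card T) (hess_del n h T))"
proof (rule bij_betw_byWitness[where f' = "extend_orient n h T"])
  have T: "T \<subseteq> {1..n}" using ind unfolding independent_def by blast
  show "\<forall>\<omega>\<in>{\<omega> \<in> acyc_orients n h. sinks n h \<omega> = T}.
          extend_orient n h T (restrict_orient T \<omega>) = \<omega>"
    using extend_restrict_orient unfolding acyc_orients_def by blast
  show "\<forall>\<omega>\<in>acyc_orients (n - card T) (hess_del n h T).
          restrict_orient T (extend_orient n h T \<omega>) = \<omega>"
    using restrict_extend_orient[OF T] unfolding acyc_orients_def by blast
  show "restrict_orient T ` {\<omega> \<in> acyc_orients n h. sinks n h \<omega> = T}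
          \<subseteq> acyc_orients (n - card T) (hess_del n h T)"
    using restrict_orient_acyc_orients[OF T] by blast
  show "extend_orient n h T ` acyc_orients (n - card T) (hess_del n h T)
          \<subseteq> {\<omega> \<in> acyc_orients n h. sinks n h \<omega> = T}"
    using extend_orient_acyc_orients[OF ind] sinks_extend_orient[OF ind dom] by blast
qed

section \<open>Counting ascents\<close>

definition ascents_into :: "nat \<Rightarrow> (nat \<Rightarrow> nat) \<Rightarrow> nat set \<Rightarrow> (nat \<times> nat) set" where
  "ascents_into n h T = {(v, w). {v, w} \<in> inc_edges n h \<and> v \<notin> T \<and> w \<in> T \<and> v < w}"

text \<open>
  Every arc starts outside the sink set.  Arcs that end in it are forced, and the others
  correspond to the arcs of the restriction, with ascents preserved because \<open>relabel\<close> is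
  strictly increasing off the sink set.
\<close>

lemma asc_split:
  assumes \<omega>: "\<omega> \<in> orientations n h" and S: "sinks n h \<omega> = T"
  shows "asc \<omega> = card (ascents_into n h T) + asc (restrict_orient T \<omega>)"
proof -
  have T: "T \<subseteq> {1..n}" using S unfolding sinks_def by blast
  have fin: "finite \<omega>" using orientations_subset[OF \<omega>] finite_subset by blast
  let ?A = "{(v, w) \<in> \<omega>. v < w}"
  let ?B = "{(v, w) \<in> \<omega>. v < w \<and> v \<notin> T \<and> w \<notin> T}"
  have ext: "\<omega> = extend_orient n h T (restrict_orient T \<omega>)"
    using extend_restrict_orient[OF \<omega>] S by simp
  have out: "v \<notin> T" if "(v, w) \<in> \<omega>" for v w
    using that by (subst (asm) ext) (simp add: extend_orient_def)
  have into: "(v, w) \<in> \<omega>" if "{v, w} \<in> inc_edges n h" "v \<notin> T" "w \<in> T" for v w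
    using that by (subst ext) (simp add: extend_orient_def)
  have A: "?A = ascents_into n h T \<union> ?B"
    using out into orientations_arcD(1)[OF \<omega>] unfolding ascents_into_def by blast
  have "finite ?A" by (rule finite_subset[OF _ fin]) auto
  then have "finite (ascents_into n h T)" "finite ?B" unfolding A by simp_all
  then have "asc \<omega> = card (ascents_into n h T) + card ?B"
    unfolding asc_def A by (intro card_Un_disjoint) (auto simp: ascents_into_def)
  moreover have "card ?B = asc (restrict_orient T \<omega>)"
  proof -
    let ?f = "map_prod (relabel T) (relabel T)"
    have inj: "inj_on ?f ?B" using relabel_inj[OF T] by (auto simp: inj_on_def)
    have "{(a, b) \<in> restrict_orient T \<omega>. a < b} = ?f ` ?B"
    proof (rule set_eqI, clarify)
      fix a b
      have "(a, b) \<in> ?f ` ?B \<longleftrightarrow>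
              (\<exists>v w. a = relabel T v \<and> b = relabel T w \<and> (v, w) \<in> \<omega> \<and> v < w \<and> v \<notin> T \<and> w \<notin> T)"
        by auto
      also have "\<dots> \<longleftrightarrow> (a, b) \<in> restrict_orient T \<omega> \<and> a < b"
        using relabel_less_iff[OF T] unfolding restrict_orient_def by blast
      finally show "(a, b) \<in> {(a, b) \<in> restrict_orient T \<omega>. a < b} \<longleftrightarrow> (a, b) \<in> ?f ` ?B"
        by simp
    qed
    then show ?thesis unfolding asc_def using card_image[OF inj] by simp
  qed
  ultimately show ?thesis by simp
qed

text \<open>
  The lower bound is \<open>asc_split\<close>; it is attained by the orientation in which all edges off
  \<open>T\<close> run downwards.
\<close>

lemma sink_deg_eq:
  assumes ind: "independent n h T" and dom: "dominating n h T"
  shows "sink_deg n h T = card (ascents_into n h T)"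
  unfolding sink_deg_def
proof (rule Min_eqI)
  have T: "T \<subseteq> {1..n}" using ind unfolding independent_def by blast
  let ?S = "{asc \<omega> |\<omega>. \<omega> \<in> acyc_orients n h \<and> sinks n h \<omega> = T}"
  have "?S \<subseteq> asc ` acyc_orients n h" by blast
  then show "finite ?S" using finite_acyc_orients finite_subset by blast
  show "card (ascents_into n h T) \<le> d" if "d \<in> ?S" for d
    using that asc_split unfolding acyc_orients_def by force
  let ?\<omega> = "rank_orient n h (sink_rank T)"
  have ac: "?\<omega> \<in> acyc_orients n h" using rank_orient_sink_rank(1)[OF ind] .
  then have or: "?\<omega> \<in> orientations n h" by (simp add: acyc_orients_def)
  have S: "sinks n h ?\<omega> = T"
    using sinks_eq_dominating[OF or rank_orient_sink_rank(2)[OF ind] dom] .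
  have "{(a, b) \<in> restrict_orient T ?\<omega>. a < b} = {}"
    using relabel_less_iff[OF T]
    by (auto simp: restrict_orient_def rank_orient_def sink_rank_def)
  then have "asc (restrict_orient T ?\<omega>) = 0" unfolding asc_def by (simp only: card.empty)
  then have "asc ?\<omega> = card (ascents_into n h T)" using asc_split[OF or S] by simp
  then show "card (ascents_into n h T) \<in> ?S" using ac S by force
qed

section \<open>The restriction map at a sink set of maximum size\<close>

theorem proposition4p10:
  fixes n m :: nat and h :: "nat \<Rightarrow> nat" and T :: "nat set"
  assumes "hessenberg n h"
    and "m = max_sink_size n h"
    and "T \<in> sink_sets n h m"
  shows "bij_betw (restrict_orient T)
           {\<omega> \<in> acyc_orients_sinks n h m. sinks n h \<omega> = T}
           (acyc_orients (n - m) (hess_del n h T))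
       \<and> (\<forall>\<omega> \<in> acyc_orients_sinks n h m. sinks n h \<omega> = T \<longrightarrow>
            asc \<omega> = sink_deg n h T + asc (restrict_orient T \<omega>))"
proof -
  have card: "card T = m" using assms(3) unfolding sink_sets_def by blast
  have ind: "independent n h T"
    using assms(3) independent_sinks unfolding sink_sets_def acyc_orients_def by blast
  have dom: "dominating n h T" using max_sink_set_dominating[OF ind] card assms(2) by simp
  have "{\<omega> \<in> acyc_orients_sinks n h m. sinks n h \<omega> = T}
          = {\<omega> \<in> acyc_orients n h. sinks n h \<omega> = T}"
    using card unfolding acyc_orients_sinks_def by blast
  moreover have "asc \<omega> = sink_deg n h T + asc (restrict_orient T \<omega>)"
    if "\<omega> \<in> acyc_orients_sinks n h m" "sinks n h \<omega> = T" for \<omega>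
    using asc_split[of \<omega> n h T] that sink_deg_eq[OF ind dom]
    unfolding acyc_orients_sinks_def acyc_orients_def by simp
  ultimately show ?thesis using bij_betw_restrict_orient[OF ind dom] card by simp
qed

end
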